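(* Let $n_0,n_1\ge 1$ be integers. Let $G$ be a connected bipartite graph with bipartition $(A_0,A_1)$, where $|A_0|=n_0$ and $|A_1|=n_1$. Let $H=H(u;n_0,n_1)$ be the tree with bipartition $(B_0,B_1)$, $|B_0|=n_0$, $|B_1|=n_1$, containing a node $u\in B_0$ whose neighborhood is exactly $B_1$, and such that every node $w\in B_1$ has degree $\deg_H(w)\in\left\{1+\left\lceil \frac{n_0-1}{n_1}\right\rceil,\ 1+\left\lfloor \frac{n_0-1}{n_1}\right\rfloor\right\}$. Then for every node $v\in A_0$, \[ C_1(u;H)\ \ge\ C_1(v;G). \]
   Context: For a connected graph $G$ and a node $v$, let $\mathrm{dist}_G(v,x)$ denote the length of a shortest $v$–$x$ path, $W_G(v)=\sum_{x\in V(G)}\mathrm{dist}_G(v,x)$, and the closeness of $v$ is $C_G(v)=1/W_G(v)$. The closeness centralization of $v$ in $G$ is $C_1(v;G)=\sum_{x\in V(G)}\big[C_G(v)-C_G(x)\big]$. The tree $H(u;n_0,n_1)$ (a rooted tree of depth at most 2 whose root $u$ is adjacent to all of one side, with the remaining $n_0-1$ nodes of $u$'s side distributed as leaves as evenly as possible among the $n_1$ neighbors of $u$) is determined up to isomorphism; $u$ is called its root. *)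

theory Defs
  imports Complex_Main "Graph_Theory.Graph_Theory"
begin

text \<open>
  A finite simple undirected graph is an instance of the locale \<^locale>\<open>graph\<close>: a finite
  symmetric digraph without loops and parallel arcs, every undirected edge being represented by
  two opposite arcs. The degree of a vertex is then its \<^const>\<open>out_degree\<close>.
\<close>

definition neighborhood :: "('a, 'b) pre_digraph \<Rightarrow> 'a \<Rightarrow> 'a set" where
  "neighborhood G v = {w. v \<rightarrow>\<^bsub>G\<^esub> w}"

definition bipartition :: "('a, 'b) pre_digraph \<Rightarrow> 'a set \<Rightarrow> 'a set \<Rightarrow> bool" where
  "bipartition G A B \<longleftrightarrow>
     A \<union> B = verts G \<and> A \<inter> B = {} \<and> arcs_ends G \<subseteq> A \<times> B \<union> B \<times> A"

text \<open>
  The library predicate \<^const>\<open>tree\<close> is not the undirected notion: traversing an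
  edge back and forth is a directed cycle of length 2, so a symmetric digraph with at least one arc
  is never a \<^const>\<open>forest\<close>. The cycles of a simple undirected graph are exactly the directed
  cycles of length at least 3 of its symmetric digraph.
\<close>

definition undirected_tree :: "('a, 'b) pre_digraph \<Rightarrow> bool" where
  "undirected_tree G \<longleftrightarrow>
     graph G \<and> Digraph_Component.connected G \<and>
     \<not> (\<exists>p. pre_digraph.cycle G p \<and> 3 \<le> length p)"

text \<open>The value of \<open>graph_dist G v x\<close> is meaningful only if there is a path from \<open>v\<close> to \<open>x\<close>.\<close>

definition graph_dist :: "('a, 'b) pre_digraph \<Rightarrow> 'a \<Rightarrow> 'a \<Rightarrow> nat" where
  "graph_dist G v x =
     (LEAST k. \<exists>p. vpath p G \<and> hd p = v \<and> last p = x \<and> vwalk_length p = k)"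

definition total_distance :: "('a, 'b) pre_digraph \<Rightarrow> 'a \<Rightarrow> nat" where
  "total_distance G v = (\<Sum>x \<in> verts G. graph_dist G v x)"

definition closeness :: "('a, 'b) pre_digraph \<Rightarrow> 'a \<Rightarrow> real" where
  "closeness G v = 1 / real (total_distance G v)"

definition closeness_centralization :: "'a \<Rightarrow> ('a, 'b) pre_digraph \<Rightarrow> real" where
  "closeness_centralization v G = (\<Sum>x \<in> verts G. closeness G v - closeness G x)"

end

theory Submission
  imports Defs
begin

unbundle no funcset_syntax

text \<open>
  Write \<open>k = n\<^sub>1\<close>, \<open>L = n\<^sub>0 - 1\<close>, \<open>N = k + L - 1\<close> and let \<open>W\<close> be the total distance of \<open>v\<close> in \<open>G\<close>.
  Choose for every \<open>x \<in> A\<^sub>0 - {v}\<close> a neighbour one step closer to \<open>v\<close>, and let \<open>d w\<close> be the number of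
  vertices that choose \<open>w \<in> A\<^sub>1\<close>. If \<open>w\<close> has distance \<open>2 t w + 1\<close> from \<open>v\<close>, then
  \<open>W = k + 2 L + 2 m\<close> with \<open>m = \<Sum>w. (1 + d w) t w\<close>, while the total distance of \<open>w\<close> is at most
  \<open>W + (2 t w + 1) (N - 2 d w)\<close> and that of a vertex choosing \<open>w\<close> is larger by at most \<open>N\<close>.
  Replacing all \<open>t w\<close> by \<open>0\<close> in these bounds, with \<open>W\<close> kept fixed, costs at most \<open>2 m / (7 W)\<close>
  altogether, since \<open>(W + a) (W + 3 a) \<ge> 7 a W\<close>. The remaining sum is concave in the numbers \<open>d w\<close>,
  so balancing them only increases it. Finally, lowering \<open>W\<close> to \<open>W' = k + 2 L\<close> turns the balanced sum
  into the centralization \<open>c\<close> of the root of \<open>H\<close> and multiplies it by at least \<open>W / W'\<close>, so it gains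
  at least \<open>2 m c / W\<close>. Because \<open>c \<ge> 1 / 7\<close> as soon as \<open>k \<ge> 2\<close>, this pays for the cost; and \<open>m = 0\<close> if
  \<open>k = 1\<close>.
\<close>

subsection \<open>Balancing sums of branches\<close>

text \<open>The closeness lost when a total distance grows from \<open>W\<close> to
  \<open>W + a\<close>; the excess \<open>a\<close> may be negative.\<close>

definition deficit :: "real \<Rightarrow> real \<Rightarrow> real" where
  "deficit W a = 1 / W - 1 / (W + a)"

text \<open>\<open>branch W N d\<close> is the contribution of a neighbour of the root together with its \<open>d\<close> leaves, whose
  total distances exceed that of the root by \<open>N - 2 d\<close> and \<open>2 N - 2 d\<close>.\<close>

definition branch :: "real \<Rightarrow> real \<Rightarrow> real \<Rightarrow> real" where
  "branch W N d = deficit W (N - 2 * d) + d * deficit W (2 * N - 2 * d)"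

lemma deficit_mono: "deficit W a \<le> deficit W b" if "0 < W + a" "a \<le> b"
  using that unfolding deficit_def by (simp add: frac_le)

text \<open>For \<open>a <= 0\<close> stretching cannot raise the deficit. For \<open>a > 0\<close>
  it adds \<open>2 t a\<close> over a product of two denominators, which are at least
  \<open>W + a\<close> and \<open>W + 3 a\<close>. Neighbours in the opposite side use the case
  \<open>N = 0\<close>, the vertices that choose them use \<open>N = k + L - 1\<close>.\<close>

lemma deficit_stretch:
  fixes W a N :: real and t :: nat
  assumes "0 < W" "0 \<le> N" "0 < W + ((2 * real t + 1) * a + N)"
  shows "deficit W ((2 * real t + 1) * a + N) \<le> deficit W (a + N) + 2 * real t / (7 * W)"
proof (cases "t = 0 \<or> a \<le> 0")
  case True
  have "(2 * real t + 1) * a + N \<le> a + N"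
    using True by (auto simp: algebra_simps mult_nonpos_nonneg)
  then have "deficit W ((2 * real t + 1) * a + N) \<le> deficit W (a + N)"
    using assms by (intro deficit_mono)
  also have "\<dots> \<le> deficit W (a + N) + 2 * real t / (7 * W)" using assms by simp
  finally show ?thesis .
next
  case False
  then have t: "real t \<ge> 1" and a: "a > 0" by auto
  let ?p = "W + a + N" and ?q = "W + (2 * real t + 1) * a + N"
  have le: "a \<le> real t * a" using t a by simp
  \<comment> \<open>For positive \<open>a\<close> and \<open>W\<close>, the quotient of the right
    side by \<open>a W\<close> has minimum 4 + 2 sqrt 3, and 7 is the largest integer below
    it.\<close>
  have "7 * (a * W) \<le> (W + a) * (W + 3 * a)"
  proof -
    have "0 \<le> (W - 3 / 2 * a)\<^sup>2 + 3 / 4 * a\<^sup>2" by simp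
    then show ?thesis by (simp add: power2_eq_square algebra_simps)
  qed
  also have "\<dots> \<le> ?p * ?q"
  proof (intro mult_mono)
    have "(2 * real t + 1) * a = 2 * (real t * a) + a" by (simp add: algebra_simps)
    then show "W + 3 * a \<le> ?q" using le assms(2) by linarith
  qed (use assms a in auto)
  finally have key: "7 * (a * W) \<le> ?p * ?q" .
  have frac: "a / r \<le> 1 / (7 * W)" if "7 * (a * W) \<le> r" "r > 0" for r
    using that assms(1) by (simp add: field_simps)
  have p: "?p > 0" and q: "?q > 0" using assms a le by (auto simp: algebra_simps)
  have "deficit W ((2 * real t + 1) * a + N) - deficit W (a + N) = 1 / ?p - 1 / ?q"
    unfolding deficit_def by (simp add: algebra_simps)
  also have "\<dots> = 2 * real t * (a / (?p * ?q))"
    using p q by (simp add: field_simps)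
  also have "\<dots> \<le> 2 * real t * (1 / (7 * W))"
    using frac[OF key] p q by (intro mult_left_mono) auto
  finally show ?thesis by simp
qed

text \<open>The scaled deficit is \<open>a / (W + a)\<close>. Hence lowering \<open>W\<close> to
  \<open>W'\<close> multiplies a nonnegative deficit by at least \<open>W / W'\<close>.\<close>

lemma scaled_deficit_antimono:
  assumes "0 < W'" "W' \<le> W" "0 \<le> a"
  shows "W * deficit W a \<le> W' * deficit W' a"
proof -
  have "W * deficit W a = a / (W + a)" "W' * deficit W' a = a / (W' + a)"
    using assms unfolding deficit_def by (auto simp: divide_simps)
  then show ?thesis using assms by (simp add: frac_le)
qed

text \<open>The error of linear interpolation of \<open>1 / y\<close> at two nodes is the divided difference
  \<open>1 / (y y\<^sub>0 y\<^sub>1)\<close> times \<open>(y - y\<^sub>0) (y - y\<^sub>1)\<close>, which has a sign because no integer lies strictly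
  between \<open>e\<close> and \<open>e + 1\<close>.\<close>

lemma inverse_chord_le:
  fixes c :: real and d e :: nat
  assumes "0 < c - 2 * real d" "0 < c - 2 * (real e + 1)"
  shows "1 / (c - 2 * real e) + (real d - real e) * (1 / (c - 2 * (real e + 1)) - 1 / (c - 2 * real e))
    \<le> 1 / (c - 2 * real d)"
proof -
  let ?y = "c - 2 * real d" and ?z = "c - 2 * real e" and ?z' = "c - 2 * (real e + 1)"
  have z: "?z > 0" using assms by simp
  have "d \<le> e \<or> d \<ge> e + 1" by linarith
  then have "(real d - real e) * (real d - real e - 1) \<ge> 0"
    by (auto intro: mult_nonpos_nonpos mult_nonneg_nonneg)
  then have "0 \<le> 4 * ((real d - real e) * (real d - real e - 1)) / (?y * ?z * ?z')"
    using assms z by simp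
  also have "\<dots> = 1 / ?y - (1 / ?z + (real d - real e) * (1 / ?z' - 1 / ?z))"
  proof -
    have "1 / (z - 2 * x) - (1 / z + x * (1 / (z - 2) - 1 / z))
        = 4 * (x * (x - 1)) / ((z - 2 * x) * z * (z - 2))" if "z - 2 * x > 0" "z > 2" for x z :: real
      using that by (simp add: divide_simps) algebra
    from this[of ?z "real d - real e"]
    have "1 / (?z - 2 * (real d - real e)) - (1 / ?z + (real d - real e) * (1 / (?z - 2) - 1 / ?z))
        = 4 * ((real d - real e) * (real d - real e - 1)) / ((?z - 2 * (real d - real e)) * ?z * (?z - 2))"
      using assms by simp
    moreover have "?z - 2 * (real d - real e) = ?y" "?z - 2 = ?z'" by auto
    ultimately show ?thesis by simp
  qed
  finally show ?thesis by simp
qed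

text \<open>Discrete concavity. The product \<open>x / (W + 2 N - 2 x)\<close> is a multiple of the
  reciprocal minus 1/2, so a branch is an affine function minus nonnegative multiples of two
  reciprocals, and each reciprocal satisfies \<open>inverse_chord_le\<close>.\<close>

lemma branch_chord_ge:
  fixes W N :: real and d e :: nat
  assumes "0 < W" "0 \<le> N" "0 < W + N - 2 * real d" "0 < W + N - 2 * (real e + 1)"
  shows "branch W N (real d) \<le>
    branch W N (real e) + (real d - real e) * (branch W N (real e + 1) - branch W N (real e))"
proof -
  define p q where "p = (\<lambda>x. 1 / (W + N - 2 * x))" and "q = (\<lambda>x. 1 / (W + 2 * N - 2 * x))"
  have eq: "branch W N x = 1 / W + 1 / 2 + x / W - p x - (W + 2 * N) / 2 * q x"
    if "0 < W + N - 2 * x" for x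
  proof -
    have "x * q x = (W + 2 * N) / 2 * q x - 1 / 2"
      using that assms unfolding q_def by (simp add: field_simps)
    moreover have "branch W N x = 1 / W + x / W - p x - x * q x"
      unfolding branch_def deficit_def p_def q_def by (simp add: algebra_simps)
    ultimately show ?thesis by simp
  qed
  have p: "p (real e) + (real d - real e) * (p (real e + 1) - p (real e)) \<le> p (real d)"
    unfolding p_def using assms by (intro inverse_chord_le) auto
  have "q (real e) + (real d - real e) * (q (real e + 1) - q (real e)) \<le> q (real d)"
    unfolding q_def using assms by (intro inverse_chord_le) auto
  then have q: "(W + 2 * N) / 2 * (q (real e) + (real d - real e) * (q (real e + 1) - q (real e)))
    \<le> (W + 2 * N) / 2 * q (real d)"
    using assms by (intro mult_left_mono) auto
  have e: "0 < W + N - 2 * real e" using assms by simp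
  show ?thesis
    unfolding eq[OF assms(3)] eq[OF assms(4)] eq[OF e]
    using p q by (simp add: algebra_simps add_divide_distrib diff_divide_distrib)
qed

text \<open>The chord of \<open>F\<close> through \<open>e\<close> and \<open>e + 1\<close> is
  affine, so its sum depends only on the number of terms and on their total. It dominates
  \<open>F\<close> on the left and agrees with \<open>F\<close> at every balanced value on the
  right.\<close>

lemma sum_le_sum_balanced:
  fixes F :: "real \<Rightarrow> real" and d :: "'a \<Rightarrow> nat" and d' :: "'b \<Rightarrow> nat"
  assumes "card A = card B" "(\<Sum>w\<in>A. d w) = (\<Sum>w\<in>B. d' w)"
    and chord: "\<And>w. w \<in> A \<Longrightarrow>
      F (real (d w)) \<le> F (real e) + (real (d w) - real e) * (F (real e + 1) - F (real e))"
    and bal: "\<And>w. w \<in> B \<Longrightarrow> d' w = e \<or> d' w = e + 1"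
  shows "(\<Sum>w\<in>A. F (real (d w))) \<le> (\<Sum>w\<in>B. F (real (d' w)))"
proof -
  let ?s = "F (real e + 1) - F (real e)"
  have "(\<Sum>w\<in>A. F (real (d w))) \<le> (\<Sum>w\<in>A. F (real e) + (real (d w) - real e) * ?s)"
    by (intro sum_mono chord)
  also have "\<dots> = real (card A) * F (real e) + (real (\<Sum>w\<in>A. d w) - real (card A) * real e) * ?s"
    by (simp add: sum.distrib sum_subtractf sum_distrib_right[symmetric])
  also have "\<dots> = (\<Sum>w\<in>B. F (real e) + (real (d' w) - real e) * ?s)"
    unfolding assms(1,2) by (simp add: sum.distrib sum_subtractf sum_distrib_right[symmetric])
  also have "\<dots> = (\<Sum>w\<in>B. F (real (d' w)))"
    using bal by (intro sum.cong) (force simp: add.commute)+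
  finally show ?thesis .
qed

text \<open>All deficits are bounded below by fractions with the common denominator
  \<open>W (W + N)\<close>, whose numerators add up to \<open>(k + L) N - 2 L\<close>. A polynomial
  inequality then remains.\<close>

lemma sum_branch_ge_seventh:
  fixes d :: "'b \<Rightarrow> nat" and k L :: nat
  assumes "card B = k" "k \<ge> 2" "(\<Sum>w\<in>B. d w) = L"
    and nonneg: "\<And>w. w \<in> B \<Longrightarrow> 0 \<le> real k + real L - 1 - 2 * real (d w)"
  shows "1 / 7 \<le> (\<Sum>w\<in>B. branch (real k + 2 * real L) (real k + real L - 1) (real (d w)))"
proof -
  let ?W = "real k + 2 * real L" and ?N = "real k + real L - 1"
  let ?q = "?W * (?W + ?N)"
  have W: "?W > 0" and N: "?N \<ge> 0" using assms(2) by auto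
  have low: "b / ?q \<le> deficit ?W a" if "0 \<le> b" "b \<le> ?N" "b \<le> a" for a b :: real
  proof -
    have "b / ?q \<le> b / (?W * (?W + b))"
      using that W by (intro divide_left_mono mult_left_mono) auto
    also have "\<dots> = deficit ?W b" using W that unfolding deficit_def by (simp add: field_simps)
    also have "\<dots> \<le> deficit ?W a" using that W by (intro deficit_mono) auto
    finally show ?thesis .
  qed
  have "(real k + real L) * ?N - 2 * real L = (\<Sum>w\<in>B. (?N - 2 * real (d w)) + real (d w) * ?N)"
    using assms(1,3) by (simp add: sum.distrib sum_subtractf sum_distrib_left[symmetric]
      sum_distrib_right[symmetric] of_nat_sum[symmetric] algebra_simps del: of_nat_sum)
  then have "((real k + real L) * ?N - 2 * real L) / ?q
      = (\<Sum>w\<in>B. (?N - 2 * real (d w)) / ?q + real (d w) * (?N / ?q))"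
    by (simp add: sum_divide_distrib add_divide_distrib)
  also have "\<dots> \<le> (\<Sum>w\<in>B. branch ?W ?N (real (d w)))"
    unfolding branch_def
  proof (intro sum_mono add_mono mult_left_mono low)
    fix w assume "w \<in> B"
    from nonneg[OF this] show "0 \<le> ?N - 2 * real (d w)" "?N \<le> 2 * ?N - 2 * real (d w)" by auto
  qed (use N in auto)
  finally have "((real k + real L) * ?N - 2 * real L) / ?q \<le> (\<Sum>w\<in>B. branch ?W ?N (real (d w)))" .
  moreover have "1 / 7 \<le> ((real k + real L) * ?N - 2 * real L) / ?q"
  proof -
    obtain j where j: "k = j + 2" using assms(2) by (metis add.commute le_Suc_ex)
    \<comment> \<open>With \<open>k = j + 2\<close>, seven times the numerator minus the denominator
      exceeds this sum of nonnegative terms by \<open>2 j\<close>.\<close>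
    have "0 \<le> (real L - 5 / 2)\<^sup>2 + 7 / 4 + 5 * (real j)\<^sup>2 + real j * (7 * real L + 12)" by simp
    then have "?q \<le> 7 * ((real k + real L) * ?N - 2 * real L)"
      unfolding j by (simp add: power2_eq_square algebra_simps)
    moreover have "?q > 0" using W N by simp
    ultimately show ?thesis by (simp add: field_simps)
  qed
  ultimately show ?thesis by linarith
qed

text \<open>The arithmetic core: \<open>A\<close>, \<open>d\<close>, \<open>t\<close> carry the data
  of \<open>G\<close>, and \<open>B\<close>, \<open>d'\<close> those of \<open>H\<close>. The
  premise \<open>bal\<close> says, with the division cleared, that \<open>d' w\<close> is the floor
  or the ceiling of \<open>L / k\<close>.\<close>

lemma branch_sum_comparison:
  fixes d t :: "'a \<Rightarrow> nat" and d' :: "'b \<Rightarrow> nat" and k L m :: nat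
  defines "N \<equiv> real k + real L - 1" and "W' \<equiv> real k + 2 * real L"
  defines "W \<equiv> W' + 2 * real m"
  assumes A: "card A = k" "(\<Sum>w\<in>A. d w) = L" and B: "card B = k" "(\<Sum>w\<in>B. d' w) = L"
    and k: "k \<ge> 1" and m: "m = (\<Sum>w\<in>A. (1 + d w) * t w)" and m0: "k = 1 \<Longrightarrow> m = 0"
    and pos: "\<And>w. w \<in> A \<Longrightarrow> 0 < W + (2 * real (t w) + 1) * (N - 2 * real (d w))"
    and bal: "\<And>w. w \<in> B \<Longrightarrow> L < k * (d' w + 1) \<and> k * d' w < L + k"
  shows "(\<Sum>w\<in>A. deficit W ((2 * real (t w) + 1) * (N - 2 * real (d w)))
      + real (d w) * deficit W ((2 * real (t w) + 1) * (N - 2 * real (d w)) + N))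
    \<le> (\<Sum>w\<in>B. branch W' N (real (d' w)))" (is "?lhs \<le> ?rhs")
proof -
  have N: "N \<ge> 0" and W': "W' > 0" and WW: "W' \<le> W" and W: "W > 0"
    using k by (auto simp: N_def W'_def W_def)
  have finA: "finite A" using A(1) k by (metis card.infinite not_one_le_zero)
  have "?lhs \<le> (\<Sum>w\<in>A. branch W N (real (d w)) + 2 / (7 * W) * real ((1 + d w) * t w))"
  proof (intro sum_mono)
    fix w assume w: "w \<in> A"
    let ?a = "N - 2 * real (d w)"
    have "deficit W ((2 * real (t w) + 1) * ?a) \<le> deficit W ?a + 2 * real (t w) / (7 * W)"
      using deficit_stretch[of W 0 "t w" ?a] pos[OF w] W by simp
    moreover have "real (d w) * deficit W ((2 * real (t w) + 1) * ?a + N)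
        \<le> real (d w) * (deficit W (?a + N) + 2 * real (t w) / (7 * W))"
      using pos[OF w] W N by (intro mult_left_mono deficit_stretch) auto
    moreover have "?a + N = 2 * N - 2 * real (d w)" by simp
    ultimately show "deficit W ((2 * real (t w) + 1) * ?a)
        + real (d w) * deficit W ((2 * real (t w) + 1) * ?a + N)
      \<le> branch W N (real (d w)) + 2 / (7 * W) * real ((1 + d w) * t w)"
      unfolding branch_def by (simp add: algebra_simps add_divide_distrib)
  qed
  also have "\<dots> = (\<Sum>w\<in>A. branch W N (real (d w))) + 2 * real m / (7 * W)"
    by (simp only: sum.distrib sum_distrib_left[symmetric] m of_nat_sum) simp
  finally have 1: "?lhs \<le> (\<Sum>w\<in>A. branch W N (real (d w))) + 2 * real m / (7 * W)" .
  show ?thesis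
  proof (cases "k = 1")
    case True
    \<comment> \<open>With a single branch nothing needs balancing: both degrees are
      \<open>L\<close>, and \<open>m = 0\<close> gives \<open>W = W'\<close>.\<close>
    then obtain a b where "A = {a}" "B = {b}" using A(1) B(1) by (auto simp: card_1_singleton_iff)
    then show ?thesis using 1 A(2) B(2) m0[OF True] by (simp add: W_def)
  next
    case False
    then have k2: "k \<ge> 2" using k by simp
    have "(\<Sum>w\<in>A. branch W N (real (d w))) \<le> (\<Sum>w\<in>B. branch W N (real (d' w)))"
    proof (rule sum_le_sum_balanced[where e = "L div k"])
      show "card A = card B" "(\<Sum>w\<in>A. d w) = (\<Sum>w\<in>B. d' w)" using A B by auto
    next
      fix w assume "w \<in> A"
      then have "d w \<le> L" using A(2) finA member_le_sum[of w A d] by auto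
      moreover have "real (L div k) \<le> real L / 2"
      proof -
        have "2 * (L div k) \<le> k * (L div k)" using k2 by simp
        also have "\<dots> \<le> L" by simp
        finally show ?thesis by linarith
      qed
      ultimately show "branch W N (real (d w)) \<le> branch W N (real (L div k))
          + (real (d w) - real (L div k)) * (branch W N (real (L div k) + 1) - branch W N (real (L div k)))"
        using W N k2 by (intro branch_chord_ge) (auto simp: W_def W'_def N_def)
    next
      fix w assume w: "w \<in> B"
      have "L div k < d' w + 1" using bal[OF w] k by (simp add: div_less_iff_less_mult mult.commute)
      moreover have "d' w \<le> (L + k) div k"
        using bal[OF w] k by (subst less_eq_div_iff_mult_less_eq) (auto simp: mult.commute)
      ultimately show "d' w = L div k \<or> d' w = L div k + 1" using k by auto
    qed
    with 1 have 2: "?lhs \<le> (\<Sum>w\<in>B. branch W N (real (d' w))) + 2 * real m / (7 * W)" by linarith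
    \<comment> \<open>Both the scaling argument and the bound 1/7 require nonnegative excesses. If
      \<open>d' w = e + 1\<close>, then balance gives \<open>k e < L\<close>, so
      \<open>2 e < L\<close> because \<open>k >= 2\<close>.\<close>
    have nonneg: "0 \<le> N - 2 * real (d' w)" if w: "w \<in> B" for w
    proof -
      have "2 * d' w \<le> L + k - 1"
      proof (cases "d' w")
        case (Suc e)
        have "k * e < L" using bal[OF w] Suc by simp
        moreover have "2 * e \<le> k * e" using k2 by simp
        ultimately show ?thesis using Suc k2 by linarith
      qed simp
      then have "real (2 * d' w) \<le> real (L + k - 1)" by (simp only: of_nat_le_iff)
      then show ?thesis using k by (simp add: N_def of_nat_diff)
    qed
    have "W * branch W N (real (d' w)) \<le> W' * branch W' N (real (d' w))" if "w \<in> B" for w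
    proof -
      have "real (d' w) * (W * deficit W (2 * N - 2 * real (d' w)))
          \<le> real (d' w) * (W' * deficit W' (2 * N - 2 * real (d' w)))"
        using W' WW N nonneg[OF that] by (intro mult_left_mono scaled_deficit_antimono) auto
      moreover have "W * deficit W (N - 2 * real (d' w)) \<le> W' * deficit W' (N - 2 * real (d' w))"
        using W' WW nonneg[OF that] by (intro scaled_deficit_antimono) auto
      ultimately show ?thesis unfolding branch_def by (simp add: algebra_simps)
    qed
    then have "W * (\<Sum>w\<in>B. branch W N (real (d' w))) \<le> W' * ?rhs"
      unfolding sum_distrib_left by (intro sum_mono)
    moreover have "W * ?lhs \<le> W * ((\<Sum>w\<in>B. branch W N (real (d' w))) + 2 * real m / (7 * W))"
      using 2 W by (intro mult_left_mono) auto
    moreover have "W * (2 * real m / (7 * W)) = 2 * real m * (1 / 7)" using W by simp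
    moreover have "2 * real m * (1 / 7) \<le> 2 * real m * ?rhs"
      using sum_branch_ge_seventh[OF B(1) k2 B(2)] nonneg
      by (intro mult_left_mono) (auto simp: N_def W'_def)
    \<comment> \<open>After multiplication by \<open>W\<close> the cost is \<open>2 m / 7\<close>,
      which is at most \<open>2 m\<close> times the right-hand sum; the two factors
      \<open>W'\<close> and \<open>2 m\<close> add up to \<open>W\<close>.\<close>
    ultimately have "W * ?lhs \<le> W' * ?rhs + 2 * real m * ?rhs" by (simp only: distrib_left)
    also have "\<dots> = W * ?rhs" by (simp add: W_def algebra_simps)
    finally show ?thesis using W by simp
  qed
qed

subsection \<open>Distances in connected bipartite graphs\<close>

text \<open>\<open>graph_dist\<close> minimises over simple paths. Powers of the adjacency relation
  describe arbitrary walks instead, for which concatenation, reversal and parity are plain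
  inductions.\<close>

lemma vwalk_imp_relpow:
  assumes "vwalk p G"
  shows "(hd p, last p) \<in> arcs_ends G ^^ vwalk_length p"
  using assms
proof (induction p rule: vwalk_induct)
  case (Cons u v es)
  then have "(u, last (v # es)) \<in> arcs_ends G ^^ Suc (vwalk_length (v # es))"
    by (intro relpow_Suc_I2[of u v]) auto
  then show ?case by (simp del: relpow.simps)
qed (auto simp: assms)

lemma (in wf_digraph) relpow_imp_vwalk:
  assumes "(v, x) \<in> arcs_ends G ^^ k" "v \<in> verts G"
  shows "\<exists>p. vwalk p G \<and> hd p = v \<and> last p = x \<and> vwalk_length p = k"
  using assms
proof (induction k arbitrary: v)
  case 0
  then show ?case by (intro exI[of _ "[v]"]) (auto simp: vwalk_def)
next
  case (Suc k)
  then obtain w where w: "(v, w) \<in> arcs_ends G" "(w, x) \<in> arcs_ends G ^^ k"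
    by (meson relpow_Suc_E2)
  then have "w \<in> verts G" by (auto simp: arcs_ends_conv)
  with Suc.IH w(2) obtain p where p: "vwalk p G" "hd p = w" "last p = x" "vwalk_length p = k"
    by blast
  then have "p \<noteq> []" by (auto simp: vwalk_def)
  with p w(1) show ?case
    by (intro exI[of _ "v # p"]) (auto intro: vwalk_wf_digraph_consI simp: Suc_le_eq)
qed

lemma length_vwalk_to_vpath: "length (vwalk_to_vpath p) \<le> length p"
proof (induction p rule: vwalk_to_vpath_induct3)
  case (in_set x xs)
  then show ?case
    using length_dropWhile_le[of "\<lambda>y. y \<noteq> x" xs] by simp
qed auto

text \<open>Cutting the loops out of a walk gives a path that is no longer.\<close>

lemma (in wf_digraph) graph_dist_le:
  assumes "(v, x) \<in> arcs_ends G ^^ k" "v \<in> verts G"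
  shows "graph_dist G v x \<le> k"
proof -
  obtain p where p: "vwalk p G" "hd p = v" "last p = x" "vwalk_length p = k"
    using relpow_imp_vwalk[OF assms] by blast
  let ?q = "vwalk_to_vpath p"
  have "graph_dist G v x \<le> vwalk_length ?q"
    unfolding graph_dist_def using p
    by (intro Least_le exI[of _ ?q])
      (auto simp: vwalk_to_vpath_hd vwalk_to_vpath_last vwalk_to_vpath_vpath)
  also have "\<dots> \<le> k" using length_vwalk_to_vpath[of p] p(4) by auto
  finally show ?thesis .
qed

lemma (in wf_digraph) relpow_graph_dist:
  assumes "(v, x) \<in> (arcs_ends G)\<^sup>*" "v \<in> verts G"
  shows "(v, x) \<in> arcs_ends G ^^ graph_dist G v x"
proof -
  obtain k where "(v, x) \<in> arcs_ends G ^^ k" using assms(1) rtrancl_power by blast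
  then obtain p where p: "vwalk p G" "hd p = v" "last p = x"
    using relpow_imp_vwalk[OF _ assms(2)] by blast
  then have "\<exists>k q. vpath q G \<and> hd q = v \<and> last q = x \<and> vwalk_length q = k"
    using vwalk_imp_ex_vpath[OF p] by auto
  from LeastI_ex[OF this] obtain q
    where "vpath q G" "hd q = v" "last q = x" "vwalk_length q = graph_dist G v x"
    unfolding graph_dist_def by blast
  then show ?thesis using vwalk_imp_relpow[of q G] by (auto simp del: vwalk_length_simp)
qed

section \<open>The metric of a connected bipartite graph\<close>

locale connected_bipartite_graph = graph G for G :: "('a, 'b) pre_digraph" (structure) +
  fixes X Y :: "'a set"
  assumes connected: "Digraph_Component.connected G"
    and bipartition: "bipartition G X Y"
begin

abbreviation "\<delta> \<equiv> graph_dist G"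

lemma verts_eq: "verts G = X \<union> Y" and disjoint: "X \<inter> Y = {}"
  using bipartition by (auto simp: bipartition_def)

lemma finite_sides: "finite X" "finite Y"
  using finite_verts unfolding verts_eq by auto

lemma edge_sym: "u \<rightarrow> v \<Longrightarrow> v \<rightarrow> u"
  using sym_arcs by (rule arcs_ends_symmetric)

lemma edge_sides: "u \<rightarrow> v \<Longrightarrow> u \<in> X \<longleftrightarrow> v \<in> Y" "u \<rightarrow> v \<Longrightarrow> u \<in> Y \<longleftrightarrow> v \<in> X"
  using bipartition unfolding bipartition_def by auto

lemma edge_verts: "u \<rightarrow> v \<Longrightarrow> u \<in> verts G" "u \<rightarrow> v \<Longrightarrow> v \<in> verts G"
  by (auto simp: arcs_ends_conv)

lemma relpow_dist:
  assumes "u \<in> verts G" "v \<in> verts G"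
  shows "(u, v) \<in> arcs_ends G ^^ \<delta> u v"
proof -
  have "u \<rightarrow>\<^sup>* v"
    using symmetric_connected_imp_strongly_connected[OF sym_arcs connected] assms by blast
  then show ?thesis using assms by (intro relpow_graph_dist reachable_rtranclI)
qed

lemma dist_self [simp]: "v \<in> verts G \<Longrightarrow> \<delta> v v = 0"
  using graph_dist_le[of v v 0] by simp

lemma dist_eq_0_iff: "u \<in> verts G \<Longrightarrow> v \<in> verts G \<Longrightarrow> \<delta> u v = 0 \<longleftrightarrow> u = v"
  using relpow_dist[of u v] by auto

lemma dist_eq_1_iff:
  assumes "u \<in> verts G" "v \<in> verts G"
  shows "\<delta> u v = 1 \<longleftrightarrow> u \<rightarrow> v"
proof
  assume "\<delta> u v = 1"
  then show "u \<rightarrow> v" using relpow_dist[OF assms] by simp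
next
  assume e: "u \<rightarrow> v"
  then have "\<delta> u v \<le> 1" using assms by (intro graph_dist_le) auto
  moreover have "u \<noteq> v" using e adj_not_same by blast
  ultimately show "\<delta> u v = 1" using dist_eq_0_iff[OF assms] by linarith
qed

lemma dist_eq_2_imp:
  assumes "u \<in> verts G" "v \<in> verts G" "\<delta> u v = 2"
  shows "\<exists>w. u \<rightarrow> w \<and> w \<rightarrow> v"
  using relpow_dist[OF assms(1,2)] assms(3) by (auto simp: numeral_2_eq_2)

lemma dist_triangle:
  assumes "u \<in> verts G" "v \<in> verts G" "w \<in> verts G"
  shows "\<delta> u w \<le> \<delta> u v + \<delta> v w"
  using assms relpow_dist[of u v] relpow_dist[of v w]
  by (intro graph_dist_le) (auto simp: relpow_add)

lemma dist_commute:
  assumes "u \<in> verts G" "v \<in> verts G"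
  shows "\<delta> u v = \<delta> v u"
proof -
  have "(y, x) \<in> arcs_ends G ^^ k" if "(x, y) \<in> arcs_ends G ^^ k" for x y k
    using that
  proof (induction k arbitrary: y)
    case (Suc k)
    then show ?case by (meson edge_sym relpow_Suc_E relpow_Suc_I2)
  qed auto
  then have "\<delta> x y \<le> \<delta> y x" if "x \<in> verts G" "y \<in> verts G" for x y
    using that relpow_dist by (intro graph_dist_le) auto
  then show ?thesis using assms by (intro antisym)
qed

text \<open>Every arc changes sides, so the parity of a walk is determined by its ends.\<close>

lemma even_dist_iff:
  assumes "u \<in> verts G" "v \<in> verts G"
  shows "even (\<delta> u v) \<longleftrightarrow> (u \<in> X \<longleftrightarrow> v \<in> X)"
proof -
  have "even k \<longleftrightarrow> (u \<in> X \<longleftrightarrow> v \<in> X)" if "(u, v) \<in> arcs_ends G ^^ k" for k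
    using that
  proof (induction k arbitrary: v)
    case (Suc k)
    then obtain w where w: "(u, w) \<in> arcs_ends G ^^ k" "w \<rightarrow> v" by (meson relpow_Suc_E)
    moreover have "w \<in> X \<longleftrightarrow> v \<notin> X"
      using edge_sides[OF w(2)] edge_verts[OF w(2)] disjoint verts_eq by auto
    ultimately show ?case using Suc.IH by auto
  qed auto
  then show ?thesis using relpow_dist[OF assms] .
qed

lemma ex_predecessor:
  assumes "v \<in> verts G" "x \<in> verts G" "x \<noteq> v"
  shows "\<exists>w. w \<rightarrow> x \<and> \<delta> v x = \<delta> v w + 1"
proof -
  obtain k where k: "\<delta> v x = Suc k"
    using dist_eq_0_iff[OF assms(1,2)] assms(3) by (cases "\<delta> v x") auto
  then obtain w where w: "(v, w) \<in> arcs_ends G ^^ k" "w \<rightarrow> x"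
    using relpow_dist[OF assms(1,2)] by (metis relpow_Suc_E)
  have wv: "w \<in> verts G" using edge_verts w(2) by blast
  have "\<delta> v w \<le> k" using w(1) assms(1) by (rule graph_dist_le)
  moreover have "\<delta> v x \<le> \<delta> v w + 1"
    using dist_triangle[OF assms(1) wv assms(2)] w(2) wv assms by (simp add: dist_eq_1_iff[symmetric])
  ultimately show ?thesis using w(2) k by (intro exI[of _ w]) auto
qed

section \<open>Total distances and their upper bounds\<close>

lemma total_distance_pos:
  assumes "v \<in> verts G" "x \<in> verts G" "x \<noteq> v"
  shows "0 < total_distance G v"
  unfolding total_distance_def using assms dist_eq_0_iff[of v x] finite_verts
  by (metis gr0I sum_eq_0_iff)

lemma card_verts: "card (verts G) = card X + card Y"
  unfolding verts_eq using finite_sides disjoint by (rule card_Un_disjoint)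

lemma sum_verts: "(\<Sum>x\<in>verts G. f x) = (\<Sum>x\<in>X. f x) + (\<Sum>x\<in>Y. f x)"
  unfolding verts_eq using finite_sides disjoint by (rule sum.union_disjoint)

text \<open>Stepping from \<open>w\<close> to \<open>x\<close> lengthens each distance by at most 1,
  except that the distance to \<open>x\<close> drops from 1 to 0; relative to the uniform bound this
  saves 2.\<close>

lemma total_distance_le_along_edge:
  assumes "w \<rightarrow> x"
  shows "real (total_distance G x) \<le> real (total_distance G w) + (real (card (verts G)) - 2)"
proof -
  have v: "w \<in> verts G" "x \<in> verts G" using edge_verts assms by auto
  have xw: "\<delta> x w = 1" "\<delta> w x = 1" using assms edge_sym v by (auto simp: dist_eq_1_iff[simplified])
  have "real (total_distance G x)
      \<le> (\<Sum>y\<in>verts G. real (\<delta> w y) + 1 - (if y = x then 2 else 0))"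
    unfolding total_distance_def of_nat_sum
  proof (rule sum_mono)
    fix y assume y: "y \<in> verts G"
    have "\<delta> x y \<le> \<delta> x w + \<delta> w y" using v y by (intro dist_triangle)
    then show "real (\<delta> x y) \<le> real (\<delta> w y) + 1 - (if y = x then 2 else 0)"
      using xw v by auto
  qed
  also have "\<dots> = real (total_distance G w) + (real (card (verts G)) - 2)"
    using v by (simp add: sum.distrib sum_subtractf total_distance_def)
  finally show ?thesis .
qed

text \<open>Moving from \<open>v\<close> to \<open>w\<close> adds at most
  \<open>\<delta> v w\<close> to each distance, but subtracts it for every vertex of
  \<open>S\<close>, which is reached from \<open>v\<close> by a shortest walk through
  \<open>w\<close>.\<close>

lemma total_distance_le_of_descendants:
  assumes "v \<in> verts G" "w \<in> verts G" "S \<subseteq> verts G"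
    and desc: "\<And>y. y \<in> S \<Longrightarrow> \<delta> v y = \<delta> v w + \<delta> w y"
  shows "real (total_distance G w)
    \<le> real (total_distance G v) + real (\<delta> v w) * (real (card (verts G)) - 2 * real (card S))"
proof -
  have "real (total_distance G w)
      \<le> (\<Sum>y\<in>verts G. real (\<delta> v y) + real (\<delta> v w) - (if y \<in> S then 2 * real (\<delta> v w) else 0))"
    unfolding total_distance_def of_nat_sum
  proof (rule sum_mono)
    fix y assume y: "y \<in> verts G"
    have "\<delta> w y \<le> \<delta> w v + \<delta> v y" using assms y by (intro dist_triangle)
    then show "real (\<delta> w y)
        \<le> real (\<delta> v y) + real (\<delta> v w) - (if y \<in> S then 2 * real (\<delta> v w) else 0)"
      using dist_commute[OF assms(1,2)] desc[of y] by auto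
  qed
  also have "\<dots> = real (total_distance G v) + real (card (verts G)) * real (\<delta> v w)
      - real (card S) * (2 * real (\<delta> v w))"
    using assms(3) by (simp add: sum.distrib sum_subtractf total_distance_def
        sum.inter_restrict[symmetric] Int_absorb1)
  finally show ?thesis by (simp add: algebra_simps)
qed

lemma closeness_centralization_split:
  assumes "v \<in> X"
  shows "closeness_centralization v G = (\<Sum>w\<in>Y. closeness G v - closeness G w)
    + (\<Sum>x\<in>X - {v}. closeness G v - closeness G x)"
  unfolding closeness_centralization_def sum_verts
  using assms finite_sides by (simp add: sum.remove)

subsection \<open>Centralization and branches\<close>

text \<open>The numbers \<open>d\<close>, \<open>t\<close>, \<open>m\<close> depend on a choice of
  predecessors, hence the \<open>obtains\<close>. Upper bounds on total distances become upper
  bounds on closeness differences.\<close>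

lemma centralization_le_branch_sum:
  fixes k L :: nat
  assumes v: "v \<in> X" and card: "card X = L + 1" "card Y = k" and k: "k \<ge> 1"
  obtains d t :: "'a \<Rightarrow> nat" and m :: nat where
    "(\<Sum>w\<in>Y. d w) = L" "m = (\<Sum>w\<in>Y. (1 + d w) * t w)" "k = 1 \<Longrightarrow> m = 0"
    "\<And>w. w \<in> Y \<Longrightarrow> 0 < real k + 2 * real L + 2 * real m
        + (2 * real (t w) + 1) * (real k + real L - 1 - 2 * real (d w))"
    "closeness_centralization v G
      \<le> (\<Sum>w\<in>Y. deficit (real k + 2 * real L + 2 * real m)
            ((2 * real (t w) + 1) * (real k + real L - 1 - 2 * real (d w)))
          + real (d w) * deficit (real k + 2 * real L + 2 * real m)
            ((2 * real (t w) + 1) * (real k + real L - 1 - 2 * real (d w)) + (real k + real L - 1)))"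
proof -
  let ?N = "real k + real L - 1"
  have vV: "v \<in> verts G" and YV: "Y \<subseteq> verts G" and XV: "X \<subseteq> verts G"
    using v verts_eq by auto
  have vY: "w \<noteq> v" if "w \<in> Y" for w using that v disjoint by auto
  have cV: "real (card (verts G)) = ?N + 2" using card card_verts by simp
  have "\<forall>x\<in>X - {v}. \<exists>w. w \<rightarrow> x \<and> \<delta> v x = \<delta> v w + 1"
    using ex_predecessor[OF vV] XV by blast
  then obtain p where p: "\<And>x. x \<in> X - {v} \<Longrightarrow> p x \<rightarrow> x \<and> \<delta> v x = \<delta> v (p x) + 1"
    by metis
  have pY: "p x \<in> Y" if "x \<in> X - {v}" for x using p[OF that] edge_sides that by auto
  define C where "C w = {x \<in> X - {v}. p x = w}" for w
  define d where "d w = card (C w)" for w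
  define t where "t w = \<delta> v w div 2" for w
  define m where "m = (\<Sum>w\<in>Y. (1 + d w) * t w)"
  let ?W = "real k + 2 * real L + 2 * real m"
  have \<delta>: "\<delta> v w = 2 * t w + 1" if "w \<in> Y" for w
  proof -
    have "odd (\<delta> v w)" using even_dist_iff[of v w] that v vV YV disjoint by auto
    then show ?thesis unfolding t_def by simp
  qed
  have group: "(\<Sum>x\<in>X - {v}. h x) = (\<Sum>w\<in>Y. \<Sum>x\<in>C w. h x)" for h :: "'a \<Rightarrow> 'c :: comm_monoid_add"
    unfolding C_def using finite_sides pY by (intro sum.group[symmetric]) auto
  have cX: "card (X - {v}) = L" using card v finite_sides by simp
  have L: "(\<Sum>w\<in>Y. d w) = L" using group[of "\<lambda>_. 1 :: nat"] cX by (simp add: d_def)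
  have tdv: "total_distance G v = k + 2 * L + 2 * m"
  proof -
    have "total_distance G v = (\<Sum>w\<in>Y. \<delta> v w) + (\<Sum>x\<in>X - {v}. \<delta> v x)"
      unfolding total_distance_def sum_verts using v vV finite_sides by (simp add: sum.remove)
    also have "(\<Sum>x\<in>X - {v}. \<delta> v x) = (\<Sum>w\<in>Y. \<Sum>x\<in>C w. 2 * t w + 2)"
      unfolding group using p \<delta> by (intro sum.cong) (auto simp: C_def)
    also have "(\<Sum>w\<in>Y. \<delta> v w) = (\<Sum>w\<in>Y. 2 * t w + 1)" using \<delta> by (intro sum.cong) auto
    finally have "total_distance G v = (\<Sum>w\<in>Y. 1 + 2 * d w + 2 * ((1 + d w) * t w))"
      by (simp add: sum.distrib[symmetric] d_def algebra_simps)
    also have "\<dots> = card Y + 2 * (\<Sum>w\<in>Y. d w) + 2 * m"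
      unfolding m_def by (simp only: sum.distrib sum_distrib_left) simp
    finally show ?thesis using L card(2) by simp
  qed
  have Wv: "real (total_distance G v) = ?W" by (simp add: tdv)
  have up: "real (total_distance G w) \<le> ?W + (2 * real (t w) + 1) * (?N - 2 * real (d w))"
    if w: "w \<in> Y" for w
  proof -
    have wV: "w \<in> verts G" using w YV by auto
    have "w \<notin> C w" using w disjoint by (auto simp: C_def)
    \<comment> \<open>Counting \<open>w\<close> itself turns the factor
      \<open>card (verts G) - 2 (d w + 1)\<close> into \<open>N - 2 d w\<close>.\<close>
    then have cS: "card (insert w (C w)) = d w + 1"
      using finite_sides by (simp add: d_def C_def)
    have "real (total_distance G w) \<le> real (total_distance G v)
        + real (\<delta> v w) * (real (card (verts G)) - 2 * real (card (insert w (C w))))"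
    proof (rule total_distance_le_of_descendants[OF vV wV])
      show "insert w (C w) \<subseteq> verts G" using wV XV by (auto simp: C_def)
      fix y assume "y \<in> insert w (C w)"
      then show "\<delta> v y = \<delta> v w + \<delta> w y"
      proof
        assume "y \<in> C w"
        then have "\<delta> v y = \<delta> v w + 1" "w \<rightarrow> y" using p by (auto simp: C_def)
        moreover from this(2) have "\<delta> w y = 1" using edge_verts dist_eq_1_iff by blast
        ultimately show ?thesis by simp
      qed (use wV in simp)
    qed
    then show ?thesis unfolding cS cV Wv \<delta>[OF w] by (simp add: algebra_simps)
  qed
  have up': "real (total_distance G x) \<le> ?W + ((2 * real (t w) + 1) * (?N - 2 * real (d w)) + ?N)"
    if "w \<in> Y" "x \<in> C w" for w x
  proof -
    have "w \<rightarrow> x" using p that by (auto simp: C_def)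
    from total_distance_le_along_edge[OF this] up[OF that(1)] show ?thesis unfolding cV by simp
  qed
  \<comment> \<open>Positivity keeps the default value of \<open>1 / 0\<close> out of the comparison
    of closeness values.\<close>
  have pos: "0 < real (total_distance G x)" if "x \<in> verts G" "x \<noteq> v" for x
    using total_distance_pos[of x v] that vV by auto
  have low: "closeness G v - closeness G x \<le> deficit ?W a"
    if "x \<in> verts G" "x \<noteq> v" "real (total_distance G x) \<le> ?W + a" for x a
    using pos[OF that(1,2)] that(3) unfolding closeness_def deficit_def Wv by (simp add: frac_le)
  show thesis
  proof
    show "(\<Sum>w\<in>Y. d w) = L" "m = (\<Sum>w\<in>Y. (1 + d w) * t w)" by (fact L, fact m_def)
  next
    assume "k = 1"
    then obtain w where Y: "Y = {w}" using card(2) by (auto simp: card_1_singleton_iff)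
    have wV: "w \<in> verts G" using Y YV by auto
    obtain x where "x \<rightarrow> v" using ex_predecessor[OF wV vV] vY[of w] Y by auto
    then have "v \<rightarrow> w" using edge_sides[of x v] edge_sym v Y by blast
    then have "\<delta> v w = 1" using vV wV dist_eq_1_iff by blast
    then show "m = 0" using Y by (simp add: m_def t_def)
  next
    fix w assume w: "w \<in> Y"
    then show "0 < ?W + (2 * real (t w) + 1) * (?N - 2 * real (d w))"
      using up[OF w] pos[of w] vY[OF w] YV by auto
  next
    have "(\<Sum>w\<in>Y. closeness G v - closeness G w)
        \<le> (\<Sum>w\<in>Y. deficit ?W ((2 * real (t w) + 1) * (?N - 2 * real (d w))))"
      using YV vY up by (intro sum_mono low) auto
    moreover have "(\<Sum>x\<in>X - {v}. closeness G v - closeness G x)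
        \<le> (\<Sum>w\<in>Y. \<Sum>x\<in>C w. deficit ?W ((2 * real (t w) + 1) * (?N - 2 * real (d w)) + ?N))"
      unfolding group using XV up' by (intro sum_mono low) (auto simp: C_def)
    ultimately show "closeness_centralization v G
        \<le> (\<Sum>w\<in>Y. deficit ?W ((2 * real (t w) + 1) * (?N - 2 * real (d w)))
          + real (d w) * deficit ?W ((2 * real (t w) + 1) * (?N - 2 * real (d w)) + ?N))"
      unfolding closeness_centralization_split[OF v] sum.distrib by (simp add: d_def)
  qed
qed

text \<open>The counterpart for \<open>H\<close>. Only the root needs its exact total distance; for
  all other vertices lower bounds suffice, and parity raises a distance above 1 to 3 and one above 2
  to 4.\<close>

lemma branch_sum_le_centralization:
  fixes k L :: nat
  assumes u: "u \<in> X" and card: "card X = L + 1" "card Y = k" and k: "k \<ge> 1"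
    and root: "\<And>w. w \<in> Y \<Longrightarrow> u \<rightarrow> w"
    and leaf: "\<And>x w w'. x \<in> X - {u} \<Longrightarrow> w \<rightarrow> x \<Longrightarrow> w' \<rightarrow> x \<Longrightarrow> w = w'"
  defines "d \<equiv> \<lambda>w. card {x \<in> X - {u}. w \<rightarrow> x}"
  shows "(\<Sum>w\<in>Y. d w) = L"
    and "(\<Sum>w\<in>Y. branch (real k + 2 * real L) (real k + real L - 1) (real (d w)))
      \<le> closeness_centralization u G"
proof -
  let ?W = "real k + 2 * real L" and ?N = "real k + real L - 1"
  have uV: "u \<in> verts G" and YV: "Y \<subseteq> verts G" and XV: "X \<subseteq> verts G"
    using u verts_eq by auto
  define C where "C w = {x \<in> X - {u}. w \<rightarrow> x}" for w
  have d: "d w = card (C w)" for w by (simp add: d_def C_def)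
  have finC: "finite (C w)" for w using finite_sides by (simp add: C_def)
  have CX: "C w \<subseteq> X" "u \<notin> C w" for w by (auto simp: C_def)
  have "\<forall>x\<in>X - {u}. \<exists>w. w \<rightarrow> x" using ex_predecessor[OF uV] XV by blast
  then obtain p where p: "\<And>x. x \<in> X - {u} \<Longrightarrow> p x \<rightarrow> x" by metis
  have pY: "p x \<in> Y" if "x \<in> X - {u}" for x using p[OF that] edge_sides that by auto
  \<comment> \<open>Neighbours of non-root vertices of \<open>X\<close> are unique, so the sets
    \<open>C w\<close> are the fibres of \<open>p\<close> and partition
    \<open>X - {u}\<close>.\<close>
  have C_p: "C w = {x \<in> X - {u}. p x = w}" for w using p leaf by (auto simp: C_def)
  have group: "(\<Sum>x\<in>X - {u}. h x) = (\<Sum>w\<in>Y. \<Sum>x\<in>C w. h x)" for h :: "'a \<Rightarrow> 'c :: comm_monoid_add"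
    unfolding C_p using finite_sides pY by (intro sum.group[symmetric]) auto
  have cX: "card (X - {u}) = L" using card u finite_sides by simp
  show "(\<Sum>w\<in>Y. d w) = L" using group[of "\<lambda>_. 1 :: nat"] cX by (simp add: d)
  have even2: "2 \<le> \<delta> x y" if "x \<in> X \<longleftrightarrow> y \<in> X" "x \<in> verts G" "y \<in> verts G" "x \<noteq> y" for x y
    using even_dist_iff[of x y] dist_eq_0_iff[of x y] that by (auto elim!: evenE)
  have odd1: "1 \<le> \<delta> x y" and odd3: "\<not> x \<rightarrow> y \<Longrightarrow> 3 \<le> \<delta> x y"
    if "\<not> (x \<in> X \<longleftrightarrow> y \<in> X)" "x \<in> verts G" "y \<in> verts G" for x y
    using even_dist_iff[of x y] dist_eq_1_iff[of x y] that by (auto elim!: oddE)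
  have even4: "4 \<le> \<delta> x y"
    if "x \<in> X \<longleftrightarrow> y \<in> X" "x \<in> verts G" "y \<in> verts G" "x \<noteq> y" "\<And>w. x \<rightarrow> w \<Longrightarrow> \<not> w \<rightarrow> y" for x y
  proof -
    have "\<delta> x y \<noteq> 2" using dist_eq_2_imp[OF that(2,3)] that(5) by auto
    moreover have "even (\<delta> x y)" using even_dist_iff that by auto
    then obtain j where "\<delta> x y = 2 * j" by (elim evenE)
    ultimately show ?thesis using even2[OF that(1-4)] by arith
  qed
  have tdu: "real (total_distance G u) = ?W"
  proof -
    have "\<delta> u w = 1" if "w \<in> Y" for w using root[OF that] edge_verts dist_eq_1_iff by blast
    then have Y1: "(\<Sum>w\<in>Y. \<delta> u w) = k" using card by simp
    have "\<delta> u x = 2" if x: "x \<in> X - {u}" for x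
    proof -
      have "u \<rightarrow> p x" "p x \<rightarrow> x" using root pY p x by auto
      then have "(u, x) \<in> arcs_ends G ^^ 2" by (auto simp: numeral_2_eq_2)
      then have "\<delta> u x \<le> 2" using uV by (rule graph_dist_le)
      moreover have "2 \<le> \<delta> u x" using x u XV by (intro even2) auto
      ultimately show ?thesis by simp
    qed
    then have "(\<Sum>x\<in>X. \<delta> u x) = 2 * L"
      using u uV finite_sides cX by (simp add: sum.remove[of X u])
    then show ?thesis using Y1 by (simp add: total_distance_def sum_verts)
  qed
  have sumC: "(\<Sum>y\<in>X. if y \<in> C w then 2 else 0) = 2 * real (d w)" for w
    using finite_sides CX[of w] by (simp add: sum.inter_restrict[symmetric] Int_absorb1 d)
  have low: "?W + (?N - 2 * real (d w)) \<le> real (total_distance G w)" if w: "w \<in> Y" for w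
  proof -
    have wV: "w \<in> verts G" and wX: "w \<notin> X" using w YV disjoint by auto
    \<comment> \<open>The two lower bounds are \<open>2 k - 2\<close> and
      \<open>3 L + 1 - 2 d w\<close>, with sum \<open>W + N - 2 d w\<close>.\<close>
    have "real (\<Sum>y\<in>Y. \<delta> w y) \<ge> (\<Sum>y\<in>Y. 2 - (if y = w then 2 else 0))"
      unfolding of_nat_sum
    proof (rule sum_mono)
      fix y assume "y \<in> Y"
      then show "2 - (if y = w then 2 else 0) \<le> real (\<delta> w y)"
        using even2[of w y] wV wX YV disjoint by auto
    qed
    moreover have "real (\<Sum>y\<in>X. \<delta> w y)
        \<ge> (\<Sum>y\<in>X. 3 - (if y = u then 2 else 0) - (if y \<in> C w then 2 else 0))"
      unfolding of_nat_sum
    proof (rule sum_mono)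
      fix y assume y: "y \<in> X"
      then show "3 - (if y = u then 2 else 0) - (if y \<in> C w then 2 else 0) \<le> real (\<delta> w y)"
        using odd1[of w y] odd3[of w y] wV wX XV by (auto simp: C_def)
    qed
    ultimately show ?thesis
      using w u finite_sides card by (simp add: total_distance_def sum_verts sum_subtractf sumC)
  qed
  have low': "?W + (2 * ?N - 2 * real (d w)) \<le> real (total_distance G x)"
    if w: "w \<in> Y" and x: "x \<in> C w" for w x
  proof -
    have xX: "x \<in> X" "x \<noteq> u" "w \<rightarrow> x" using x by (auto simp: C_def)
    have xV: "x \<in> verts G" using xX XV by auto
    have nb: "x \<rightarrow> w' \<longleftrightarrow> w' = w" for w' using leaf[of x w' w] xX edge_sym by blast
    have "real (\<Sum>y\<in>Y. \<delta> x y) \<ge> (\<Sum>y\<in>Y. 3 - (if y = w then 2 else 0))"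
      unfolding of_nat_sum
    proof (rule sum_mono)
      fix y assume "y \<in> Y"
      then show "3 - (if y = w then 2 else 0) \<le> real (\<delta> x y)"
        using odd1[of x y] odd3[of x y] nb xV xX YV disjoint by auto
    qed
    \<comment> \<open>At \<open>y = x\<close> two corrections apply, since \<open>x\<close> lies in
      \<open>C w\<close>, and the bound is 0. The sum is \<open>4 L - 2 d w\<close>, to be added to
      \<open>3 k - 2\<close> from \<open>Y\<close>.\<close>
    moreover have "real (\<Sum>y\<in>X. \<delta> x y)
        \<ge> (\<Sum>y\<in>X. 4 - (if y = x then 2 else 0) - (if y = u then 2 else 0) - (if y \<in> C w then 2 else 0))"
      unfolding of_nat_sum
    proof (rule sum_mono)
      fix y assume y: "y \<in> X"
      have "2 \<le> \<delta> x y" if "y \<noteq> x" using even2[of x y] that y xX XV by auto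
      moreover have "4 \<le> \<delta> x y" if "y \<noteq> x" "y \<noteq> u" "y \<notin> C w"
        using even4[of x y] that y xX XV nb by (auto simp: C_def)
      ultimately show "4 - (if y = x then 2 else 0) - (if y = u then 2 else 0)
          - (if y \<in> C w then 2 else 0) \<le> real (\<delta> x y)"
        using x xX CX[of w] by auto
    qed
    ultimately show ?thesis
      using w u xX(1) finite_sides card
      by (simp add: total_distance_def sum_verts sum_subtractf sumC)
  qed
  have ge: "deficit ?W a \<le> closeness G u - closeness G x"
    if "?W + a \<le> real (total_distance G x)" "0 < ?W + a" for x a
    using that unfolding closeness_def deficit_def tdu by (simp add: frac_le)
  have dL: "d w \<le> L" for w
    unfolding d using card_mono[of "X - {u}" "C w"] finite_sides cX by (auto simp: C_def)
  have pos: "0 < ?W + (?N - 2 * real (d w))" "0 < ?W + (2 * ?N - 2 * real (d w))" for w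
    using dL[of w] k by auto
  have "(\<Sum>w\<in>Y. deficit ?W (?N - 2 * real (d w))) \<le> (\<Sum>w\<in>Y. closeness G u - closeness G w)"
    using low pos by (intro sum_mono ge)
  moreover have "(\<Sum>w\<in>Y. \<Sum>x\<in>C w. deficit ?W (2 * ?N - 2 * real (d w)))
      \<le> (\<Sum>x\<in>X - {u}. closeness G u - closeness G x)"
    unfolding group using low' pos by (intro sum_mono ge) auto
  ultimately show "(\<Sum>w\<in>Y. branch ?W ?N (real (d w))) \<le> closeness_centralization u G"
    unfolding closeness_centralization_split[OF u] branch_def sum.distrib by (simp add: d)
qed

text \<open>Otherwise \<open>u\<close>, \<open>w\<close>, \<open>x\<close>, \<open>w'\<close> would
  form a 4-cycle.\<close>

lemma unique_neighbor_if_acyclic: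
  assumes acyclic: "\<not> (\<exists>c. cycle c \<and> 3 \<le> length c)"
    and u: "u \<rightarrow> w" "u \<rightarrow> w'" and x: "w \<rightarrow> x" "w' \<rightarrow> x" and "x \<noteq> u"
  shows "w = w'"
proof (rule ccontr)
  assume ne: "w \<noteq> w'"
  from u x edge_sym have "u \<rightarrow> w" "w \<rightarrow> x" "x \<rightarrow> w'" "w' \<rightarrow> u" by auto
  then obtain e1 e2 e3 e4 where e: "{e1, e2, e3, e4} \<subseteq> arcs G"
    "tail G e1 = u" "head G e1 = w" "tail G e2 = w" "head G e2 = x"
    "tail G e3 = x" "head G e3 = w'" "tail G e4 = w'" "head G e4 = u"
    unfolding arcs_ends_conv by auto
  have "u \<noteq> w" "w \<noteq> x" "x \<noteq> w'" "w' \<noteq> u" using u x adj_not_same edge_sym by blast+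
  then have "cycle [e1, e2, e3, e4]"
    unfolding cycle_def awalk_def
    using e ne \<open>x \<noteq> u\<close> edge_verts(1)[OF u(1)] by (intro exI[of _ u]) auto
  with acyclic show False by force
qed

lemma out_degree_eq_card_neighbors: "out_degree G w = card {y. w \<rightarrow> y}"
proof -
  have "{y. w \<rightarrow> y} = head G ` out_arcs G w" by (auto simp: arcs_ends_conv out_arcs_def)
  moreover have "inj_on (head G) (out_arcs G w)"
    by (auto intro!: inj_onI no_multi_arcs simp: out_arcs_def arc_to_ends_def)
  ultimately show ?thesis by (simp add: out_degree_def card_image)
qed

end

text \<open>Floor and ceiling both differ from \<open>L / k\<close> by less than 1; multiplying by
  \<open>k\<close> leaves inequalities between natural numbers.\<close>

lemma balanced_bounds:
  fixes d k L :: nat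
  assumes "k \<ge> 1" "int d \<in> {\<lceil>real L / real k\<rceil>, \<lfloor>real L / real k\<rfloor>}"
  shows "L < k * (d + 1) \<and> k * d < L + k"
proof -
  have "real d - 1 < real L / real k \<and> real L / real k < real d + 1"
    using assms(2) by (auto simp: ceiling_eq_iff floor_eq_iff dest!: sym[of "int d"])
  then have "(real d - 1) * real k < real L" "real L < (real d + 1) * real k"
    using assms(1) by (auto simp: field_simps)
  then have "real (k * d) < real (L + k)" "real L < real (k * (d + 1))"
    by (auto simp: algebra_simps)
  then show ?thesis by (simp only: of_nat_less_iff)
qed

section \<open>The comparison of \<open>G\<close> with \<open>H\<close>\<close>

theorem theorem2:
  fixes n\<^sub>0 n\<^sub>1 :: nat
    and G :: "('a, 'b) pre_digraph" and A\<^sub>0 A\<^sub>1 :: "'a set"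
    and H :: "('c, 'd) pre_digraph" and B\<^sub>0 B\<^sub>1 :: "'c set" and u :: 'c
  assumes "n\<^sub>0 \<ge> 1" and "n\<^sub>1 \<ge> 1"
    and "graph G" and "Digraph_Component.connected G"
    and "bipartition G A\<^sub>0 A\<^sub>1" and "card A\<^sub>0 = n\<^sub>0" and "card A\<^sub>1 = n\<^sub>1"
    and "undirected_tree H"
    and "bipartition H B\<^sub>0 B\<^sub>1" and "card B\<^sub>0 = n\<^sub>0" and "card B\<^sub>1 = n\<^sub>1"
    and "u \<in> B\<^sub>0" and "neighborhood H u = B\<^sub>1"
    and "\<forall>w \<in> B\<^sub>1. int (out_degree H w) \<in>
           {1 + \<lceil>(real n\<^sub>0 - 1) / real n\<^sub>1\<rceil>, 1 + \<lfloor>(real n\<^sub>0 - 1) / real n\<^sub>1\<rfloor>}"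
  shows "\<forall>v \<in> A\<^sub>0. closeness_centralization u H \<ge> closeness_centralization v G"
proof
  fix v assume v: "v \<in> A\<^sub>0"
  interpret G: connected_bipartite_graph G A\<^sub>0 A\<^sub>1
    using assms(3-5) by (simp add: connected_bipartite_graph_def connected_bipartite_graph_axioms_def)
  interpret H: connected_bipartite_graph H B\<^sub>0 B\<^sub>1
    using assms(8,9) by (simp add: undirected_tree_def connected_bipartite_graph_def
        connected_bipartite_graph_axioms_def)
  define L where "L = n\<^sub>0 - 1"
  have n0: "n\<^sub>0 = L + 1" using assms(1) by (simp add: L_def)
  have root: "u \<rightarrow>\<^bsub>H\<^esub> w \<longleftrightarrow> w \<in> B\<^sub>1" for w using assms(13) by (auto simp: neighborhood_def)
  have leaf: "w = w'" if "x \<in> B\<^sub>0 - {u}" "w \<rightarrow>\<^bsub>H\<^esub> x" "w' \<rightarrow>\<^bsub>H\<^esub> x" for x w w'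
  proof (rule H.unique_neighbor_if_acyclic)
    show "\<not> (\<exists>c. H.cycle c \<and> 3 \<le> length c)" using assms(8) by (simp add: undirected_tree_def)
    show "u \<rightarrow>\<^bsub>H\<^esub> w" "u \<rightarrow>\<^bsub>H\<^esub> w'" using that root H.edge_sides(2) by auto
  qed (use that in auto)
  define d where "d w = card {x \<in> B\<^sub>0 - {u}. w \<rightarrow>\<^bsub>H\<^esub> x}" for w
  have H: "(\<Sum>w\<in>B\<^sub>1. d w) = L"
      "(\<Sum>w\<in>B\<^sub>1. branch (real n\<^sub>1 + 2 * real L) (real n\<^sub>1 + real L - 1) (real (d w)))
        \<le> closeness_centralization u H"
    using H.branch_sum_le_centralization[OF assms(12) _ assms(11,2) _ leaf, of L] root assms(10) n0
    unfolding d_def by auto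
  have bal: "L < n\<^sub>1 * (d w + 1) \<and> n\<^sub>1 * d w < L + n\<^sub>1" if w: "w \<in> B\<^sub>1" for w
  proof (rule balanced_bounds[OF assms(2)])
    \<comment> \<open>The root accounts for the summand 1 in the prescribed degree, so
      \<open>d w\<close> itself is the floor or the ceiling.\<close>
    have "{y. w \<rightarrow>\<^bsub>H\<^esub> y} = insert u {x \<in> B\<^sub>0 - {u}. w \<rightarrow>\<^bsub>H\<^esub> x}"
      using root w H.edge_sym H.edge_sides(2)[of w] by blast
    moreover have "card (insert u {x \<in> B\<^sub>0 - {u}. w \<rightarrow>\<^bsub>H\<^esub> x}) = d w + 1"
      unfolding d_def using H.finite_sides by (subst card_insert_disjoint) auto
    ultimately have "out_degree H w = d w + 1"
      by (simp only: H.out_degree_eq_card_neighbors)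
    then show "int (d w) \<in> {\<lceil>real L / real n\<^sub>1\<rceil>, \<lfloor>real L / real n\<^sub>1\<rfloor>}"
      using bspec[OF assms(14) w] by (simp add: n0)
  qed
  obtain d' t m where G: "(\<Sum>w\<in>A\<^sub>1. d' w) = L" "m = (\<Sum>w\<in>A\<^sub>1. (1 + d' w) * t w)" "n\<^sub>1 = 1 \<Longrightarrow> m = 0"
    "\<And>w. w \<in> A\<^sub>1 \<Longrightarrow> 0 < real n\<^sub>1 + 2 * real L + 2 * real m
        + (2 * real (t w) + 1) * (real n\<^sub>1 + real L - 1 - 2 * real (d' w))"
    "closeness_centralization v G
      \<le> (\<Sum>w\<in>A\<^sub>1. deficit (real n\<^sub>1 + 2 * real L + 2 * real m)
            ((2 * real (t w) + 1) * (real n\<^sub>1 + real L - 1 - 2 * real (d' w)))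
          + real (d' w) * deficit (real n\<^sub>1 + 2 * real L + 2 * real m)
            ((2 * real (t w) + 1) * (real n\<^sub>1 + real L - 1 - 2 * real (d' w)) + (real n\<^sub>1 + real L - 1)))"
    by (rule G.centralization_le_branch_sum[OF v assms(6)[unfolded n0] assms(7,2)]) (rule that)
  show "closeness_centralization v G \<le> closeness_centralization u H"
    using G(5) branch_sum_comparison[OF assms(7) G(1) assms(11) H(1) assms(2) G(2-4) bal] H(2)
    by linarith
qed

end
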